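(* Let $T$ and $\Omega$ be bounded positive operators on $L^2(G,\mathbb{C}^{s\times r})$ that are adjointable with respect to the matrix-valued inner product, and let $\{E_k\}_{k\in\mathbb{N}}$ be a matrix-valued orthonormal basis for $L^2(G,\mathbb{C}^{s\times r})$ such that $\{TE_k\}_{k\in\mathbb{N}}$ is a matrix-valued Riesz basis. If $\mathrm{tr}\langle T\mathbf{f},\mathbf{f}\rangle\le\mathrm{tr}\langle\Omega\mathbf{f},\mathbf{f}\rangle$ for all $\mathbf{f}\in L^2(G,\mathbb{C}^{s\times r})$, then $\{\Omega E_k\}_{k\in\mathbb{N}}$ is a matrix-valued Riesz basis for $L^2(G,\mathbb{C}^{s\times r})$.
   Context: $G$ is a locally compact abelian group that is metrizable and $\sigma$-compact, with Haar measure $\mu_G$; $s,r\in\mathbb{N}$. $L^2(G,\mathbb{C}^{s\times r})$ is the space of $s\times r$ matrices with all entries in $L^2(G)$. The matrix-valued inner product is $\langle \mathbf{f},\mathbf{g}\rangle=\int_G \mathbf{f}(x)\mathbf{g}^*(x)\,d\mu_G\in M_s(\mathbb{C})$ (entrywise integral). $L^2(G,\mathbb{C}^{s\times r})$ is a Hilbert space with inner product $\langle \mathbf{f},\mathbf{g}\rangle_{L^2}=\mathrm{tr}\langle \mathbf{f},\mathbf{g}\rangle$ and Frobenius norm; $U^*$ denotes the Hilbert-adjoint with respect to this inner product. $U$ is adjointable with respect to the matrix-valued inner product if $\langle U\mathbf{f},\mathbf{g}\rangle=\langle\mathbf{f},U^*\mathbf{g}\rangle$ for all $\mathbf{f},\mathbf{g}$.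 A bounded operator $P$ is positive if $P^*=P$ and $\mathrm{tr}\langle P\mathbf{f},\mathbf{f}\rangle\ge0$ for all $\mathbf{f}$. A matrix-valued orthonormal basis is a sequence $\{E_k\}_{k\in\mathbb{N}}$ with $\langle E_k,E_j\rangle=\mathbf{I}_{s\times s}$ if $k=j$ and $\mathbf{O}_{s\times s}$ otherwise, such that $\mathbf{f}=\sum_k\langle\mathbf{f},E_k\rangle E_k$ in Frobenius norm for all $\mathbf{f}$. A matrix-valued Riesz basis is a family $\{VE_k\}_{k\in\mathbb{N}}$ with $\{E_k\}$ a matrix-valued orthonormal basis and $V$ bounded, linear, bijective and adjointable with respect to the matrix-valued inner product. *)

theory Defs
  imports "HOL-Analysis.Analysis"
begin

definition metr_sigma_compact_LCA :: "'g::topological_ab_group_add itself \<Rightarrow> bool" where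
  "metr_sigma_compact_LCA _ \<longleftrightarrow>
     locally_compact_space (euclidean :: 'g topology) \<and>
     metrizable_space (euclidean :: 'g topology) \<and>
     (\<exists>K :: nat \<Rightarrow> 'g set. (\<forall>n. compact (K n)) \<and> (\<Union>n. K n) = UNIV)"

definition haar_measure :: "'g::topological_ab_group_add measure \<Rightarrow> bool" where
  "haar_measure M \<longleftrightarrow>
     sets M = sets borel \<and>
     (\<forall>A\<in>sets M. \<forall>a. emeasure M ((\<lambda>x. a + x) ` A) = emeasure M A) \<and>
     (\<forall>K. compact K \<longrightarrow> emeasure M K < \<infinity>) \<and>
     (\<forall>U. open U \<and> U \<noteq> {} \<longrightarrow> emeasure M U > 0) \<and>
     (\<forall>A\<in>sets M. emeasure M A = (INF U\<in>{U. open U \<and> A \<subseteq> U}. emeasure M U)) \<and>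
     (\<forall>U. open U \<longrightarrow> emeasure M U = (SUP K\<in>{K. compact K \<and> K \<subseteq> U}. emeasure M K))"

text \<open>Elements of L2(G, C^{s x r}) are represented by functions G \<Rightarrow> complex^'r^'s
  (rows indexed by 's, columns by 'r); equality in L2 is equality almost everywhere.\<close>

definition L2m :: "'g measure \<Rightarrow> ('g \<Rightarrow> complex^'r^'s) set" where
  "L2m M = {f. \<forall>i j. (\<lambda>x. f x $ i $ j) \<in> borel_measurable M \<and>
                     integrable M (\<lambda>x. (cmod (f x $ i $ j))\<^sup>2)}"

definition ae_eq :: "'g measure \<Rightarrow> ('g \<Rightarrow> 'b) \<Rightarrow> ('g \<Rightarrow> 'b) \<Rightarrow> bool" where
  "ae_eq M f g \<longleftrightarrow> (AE x in M. f x = g x)"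

text \<open>Matrix-valued inner product  <f,g> = \<integral> f(x) g(x)^* d\<mu> (entrywise).\<close>
definition minner :: "'g measure \<Rightarrow> ('g \<Rightarrow> complex^'r^'s) \<Rightarrow> ('g \<Rightarrow> complex^'r^'s) \<Rightarrow> complex^'s^'s" where
  "minner M f g = (\<chi> i j. integral\<^sup>L M (\<lambda>x. \<Sum>k\<in>UNIV. f x $ i $ k * cnj (g x $ j $ k)))"

definition mtrace :: "complex^'n^'n \<Rightarrow> complex" where
  "mtrace A = (\<Sum>i\<in>UNIV. A $ i $ i)"

definition hinner :: "'g measure \<Rightarrow> ('g \<Rightarrow> complex^'r^'s) \<Rightarrow> ('g \<Rightarrow> complex^'r^'s) \<Rightarrow> complex" where
  "hinner M f g = mtrace (minner M f g)"

definition l2norm :: "'g measure \<Rightarrow> ('g \<Rightarrow> complex^'r^'s) \<Rightarrow> real" where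
  "l2norm M f = sqrt (Re (hinner M f f))"

definition fscale :: "complex \<Rightarrow> ('g \<Rightarrow> complex^'r^'s) \<Rightarrow> ('g \<Rightarrow> complex^'r^'s)" where
  "fscale c f = (\<lambda>x. \<chi> i j. c * f x $ i $ j)"

definition mleft :: "complex^'s^'s \<Rightarrow> ('g \<Rightarrow> complex^'r^'s) \<Rightarrow> ('g \<Rightarrow> complex^'r^'s)" where
  "mleft A f = (\<lambda>x. A ** f x)"

definition bounded_op :: "'g measure \<Rightarrow> (('g \<Rightarrow> complex^'r^'s) \<Rightarrow> ('g \<Rightarrow> complex^'r^'s)) \<Rightarrow> bool" where
  "bounded_op M U \<longleftrightarrow>
     (\<forall>f\<in>L2m M. U f \<in> L2m M) \<and>
     (\<forall>f\<in>L2m M. \<forall>g\<in>L2m M. ae_eq M f g \<longrightarrow> ae_eq M (U f) (U g)) \<and>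
     (\<forall>f\<in>L2m M. \<forall>g\<in>L2m M. ae_eq M (U (\<lambda>x. f x + g x)) (\<lambda>x. U f x + U g x)) \<and>
     (\<forall>f\<in>L2m M. \<forall>c. ae_eq M (U (fscale c f)) (fscale c (U f))) \<and>
     (\<exists>C. \<forall>f\<in>L2m M. l2norm M (U f) \<le> C * l2norm M f)"

definition is_hadjoint :: "'g measure \<Rightarrow> (('g \<Rightarrow> complex^'r^'s) \<Rightarrow> ('g \<Rightarrow> complex^'r^'s))
    \<Rightarrow> (('g \<Rightarrow> complex^'r^'s) \<Rightarrow> ('g \<Rightarrow> complex^'r^'s)) \<Rightarrow> bool" where
  "is_hadjoint M U V \<longleftrightarrow> bounded_op M V \<and>
     (\<forall>f\<in>L2m M. \<forall>g\<in>L2m M. hinner M (U f) g = hinner M f (V g))"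

definition m_adjointable :: "'g measure \<Rightarrow> (('g \<Rightarrow> complex^'r^'s) \<Rightarrow> ('g \<Rightarrow> complex^'r^'s)) \<Rightarrow> bool" where
  "m_adjointable M U \<longleftrightarrow> (\<exists>V. is_hadjoint M U V \<and>
     (\<forall>f\<in>L2m M. \<forall>g\<in>L2m M. minner M (U f) g = minner M f (V g)))"

definition positive_op :: "'g measure \<Rightarrow> (('g \<Rightarrow> complex^'r^'s) \<Rightarrow> ('g \<Rightarrow> complex^'r^'s)) \<Rightarrow> bool" where
  "positive_op M P \<longleftrightarrow> bounded_op M P \<and> is_hadjoint M P P \<and>
     (\<forall>f\<in>L2m M. Im (hinner M (P f) f) = 0 \<and> Re (hinner M (P f) f) \<ge> 0)"

definition bij_op :: "'g measure \<Rightarrow> (('g \<Rightarrow> complex^'r^'s) \<Rightarrow> ('g \<Rightarrow> complex^'r^'s)) \<Rightarrow> bool" where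
  "bij_op M U \<longleftrightarrow>
     (\<forall>f\<in>L2m M. \<forall>g\<in>L2m M. ae_eq M (U f) (U g) \<longrightarrow> ae_eq M f g) \<and>
     (\<forall>h\<in>L2m M. \<exists>f\<in>L2m M. ae_eq M (U f) h)"

definition m_onb :: "'g measure \<Rightarrow> (nat \<Rightarrow> 'g \<Rightarrow> complex^'r^'s) \<Rightarrow> bool" where
  "m_onb M E \<longleftrightarrow>
     (\<forall>k. E k \<in> L2m M) \<and>
     (\<forall>k j. minner M (E k) (E j) = (if k = j then mat 1 else 0)) \<and>
     (\<forall>f\<in>L2m M. (\<lambda>n. l2norm M (\<lambda>x. f x - (\<Sum>k<n. mleft (minner M f (E k)) (E k) x)))
                   \<longlonglongrightarrow> 0)"

definition m_riesz_basis :: "'g measure \<Rightarrow> (nat \<Rightarrow> 'g \<Rightarrow> complex^'r^'s) \<Rightarrow> bool" where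
  "m_riesz_basis M F \<longleftrightarrow>
     (\<exists>E V. m_onb M E \<and> bounded_op M V \<and> bij_op M V \<and> m_adjointable M V \<and>
            (\<forall>k. ae_eq M (F k) (V (E k))))"

end

theory Submission
  imports Defs
begin

text \<open>
  Everything reduces to a lower bound \<open>m \<parallel>f\<parallel>\<^sup>2 \<le> \<langle>T f, f\<rangle>\<close> with \<open>m > 0\<close>: it passes to \<open>\<Omega>\<close>, and a bounded
  coercive operator is bijective, so \<open>\<Omega>\<close> itself maps the orthonormal basis \<open>E\<close> to a Riesz basis.
  Write \<open>T (E k) = V (E' k)\<close> with \<open>V\<close> bijective. By Parseval \<open>\<parallel>T f\<parallel> = \<parallel>V\<^sup>* f\<parallel>\<close>, and \<open>V\<^sup>*\<close> is bounded below
  because \<open>V\<close> is surjective. Hence \<open>c \<parallel>f\<parallel> \<le> \<parallel>T f\<parallel>\<close>, and Cauchy-Schwarz for the positive form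
  \<open>\<langle>T f, g\<rangle>\<close> gives \<open>\<parallel>T f\<parallel>\<^sup>2 \<le> \<parallel>T\<parallel> \<langle>T f, f\<rangle>\<close>. Only the real part of the inner product matters for
  these estimates, so they are carried out for functions with values in a real Euclidean space;
  equality is always modulo null sets.
\<close>

section \<open>Square-integrable functions with values in a Euclidean space\<close>

text \<open>One global measurability condition takes the place of the entrywise ones in
  \<open>L2m\<close>; \<open>L2m_eq_L2fun\<close> identifies the two sets for matrices.\<close>

definition L2fun :: "'a measure \<Rightarrow> ('a \<Rightarrow> 'b::euclidean_space) set" where
  "L2fun M = {f. f \<in> borel_measurable M \<and> integrable M (\<lambda>x. (norm (f x))\<^sup>2)}"

definition L2_inner :: "'a measure \<Rightarrow> ('a \<Rightarrow> 'b::euclidean_space) \<Rightarrow> ('a \<Rightarrow> 'b) \<Rightarrow> real" where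
  "L2_inner M f g = (LINT x|M. f x \<bullet> g x)"

definition L2_norm :: "'a measure \<Rightarrow> ('a \<Rightarrow> 'b::euclidean_space) \<Rightarrow> real" where
  "L2_norm M f = sqrt (L2_inner M f f)"

lemma L2fun_measurable: "f \<in> L2fun M \<Longrightarrow> f \<in> borel_measurable M"
  by (simp add: L2fun_def)

lemma L2fun_integrable_inner:
  assumes "f \<in> L2fun M" "g \<in> L2fun M"
  shows "integrable M (\<lambda>x. f x \<bullet> g x)"
proof (rule Bochner_Integration.integrable_bound)
  show "integrable M (\<lambda>x. (norm (f x))\<^sup>2 + (norm (g x))\<^sup>2)"
    using assms by (auto simp: L2fun_def)
  show "(\<lambda>x. f x \<bullet> g x) \<in> borel_measurable M"
    using assms by (auto simp: L2fun_def intro: borel_measurable_inner)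
  have "\<bar>a \<bullet> b\<bar> \<le> (norm a)\<^sup>2 + (norm b)\<^sup>2" for a b :: 'b
    using Cauchy_Schwarz_ineq2[of a b] sum_squares_bound[of "norm a" "norm b"]
      mult_nonneg_nonneg[OF norm_ge_zero[of a] norm_ge_zero[of b]] by linarith
  then show "AE x in M. norm (f x \<bullet> g x) \<le> norm ((norm (f x))\<^sup>2 + (norm (g x))\<^sup>2)"
    by simp
qed

lemma L2fun_zero [simp]: "(\<lambda>x. 0) \<in> L2fun M"
  by (simp add: L2fun_def)

lemma L2fun_scaleR:
  assumes "f \<in> L2fun M" shows "(\<lambda>x. c *\<^sub>R f x) \<in> L2fun M"
  using assms by (auto simp: L2fun_def power_mult_distrib)

lemma L2fun_add:
  assumes "f \<in> L2fun M" "g \<in> L2fun M"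
  shows "(\<lambda>x. f x + g x) \<in> L2fun M"
proof -
  have "integrable M (\<lambda>x. f x \<bullet> f x + 2 * (f x \<bullet> g x) + g x \<bullet> g x)"
    using assms by (intro Bochner_Integration.integrable_add integrable_mult_right L2fun_integrable_inner) auto
  moreover have "(norm (f x + g x))\<^sup>2 = f x \<bullet> f x + 2 * (f x \<bullet> g x) + g x \<bullet> g x" for x
    by (simp add: power2_norm_eq_inner algebra_simps inner_commute)
  ultimately show ?thesis
    using assms by (auto simp: L2fun_def)
qed

lemma L2fun_diff:
  assumes "f \<in> L2fun M" "g \<in> L2fun M"
  shows "(\<lambda>x. f x - g x) \<in> L2fun M"
  using L2fun_add[OF assms(1) L2fun_scaleR[OF assms(2), of "-1"]] by simp

lemma L2fun_sum:
  assumes "\<And>i. i \<in> I \<Longrightarrow> f i \<in> L2fun M"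
  shows "(\<lambda>x. \<Sum>i\<in>I. f i x) \<in> L2fun M"
  using assms
proof (induction I rule: infinite_finite_induct)
  case (insert i I)
  then have "(\<lambda>x. f i x + (\<Sum>i\<in>I. f i x)) \<in> L2fun M"
    by (intro L2fun_add) auto
  then show ?case using insert by simp
qed auto

lemma L2_inner_commute: "L2_inner M f g = L2_inner M g f"
  by (simp add: L2_inner_def inner_commute)

lemma L2_inner_add_left:
  assumes "f \<in> L2fun M" "g \<in> L2fun M" "h \<in> L2fun M"
  shows "L2_inner M (\<lambda>x. f x + g x) h = L2_inner M f h + L2_inner M g h"
  unfolding L2_inner_def using assms
  by (simp add: inner_add_left L2fun_integrable_inner)

lemma L2_inner_diff_left:
  assumes "f \<in> L2fun M" "g \<in> L2fun M" "h \<in> L2fun M"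
  shows "L2_inner M (\<lambda>x. f x - g x) h = L2_inner M f h - L2_inner M g h"
  unfolding L2_inner_def using assms
  by (simp add: inner_diff_left L2fun_integrable_inner)

lemma L2_inner_scaleR_left:
  "L2_inner M (\<lambda>x. c *\<^sub>R f x) h = c * L2_inner M f h"
  unfolding L2_inner_def by simp

lemma L2_inner_sum_right:
  assumes "f \<in> L2fun M" "\<And>i. i \<in> I \<Longrightarrow> g i \<in> L2fun M"
  shows "L2_inner M f (\<lambda>x. \<Sum>i\<in>I. g i x) = (\<Sum>i\<in>I. L2_inner M f (g i))"
  unfolding L2_inner_def inner_sum_right using assms
  by (intro Bochner_Integration.integral_sum L2fun_integrable_inner) auto

lemma L2_inner_add_right:
  assumes "f \<in> L2fun M" "g \<in> L2fun M" "h \<in> L2fun M"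
  shows "L2_inner M h (\<lambda>x. f x + g x) = L2_inner M h f + L2_inner M h g"
  using L2_inner_add_left[OF assms] by (simp only: L2_inner_commute[of M h])

lemma L2_inner_diff_right:
  assumes "f \<in> L2fun M" "g \<in> L2fun M" "h \<in> L2fun M"
  shows "L2_inner M h (\<lambda>x. f x - g x) = L2_inner M h f - L2_inner M h g"
  using L2_inner_diff_left[OF assms] by (simp only: L2_inner_commute[of M h])

lemma L2_inner_scaleR_right:
  "L2_inner M h (\<lambda>x. c *\<^sub>R f x) = c * L2_inner M h f"
  using L2_inner_scaleR_left[of M c f h] by (simp only: L2_inner_commute[of M h])

lemma L2_inner_cong_AE:
  assumes "f \<in> L2fun M" "f' \<in> L2fun M" "g \<in> L2fun M" "g' \<in> L2fun M"
    and "AE x in M. f x = f' x" "AE x in M. g x = g' x"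
  shows "L2_inner M f g = L2_inner M f' g'"
  unfolding L2_inner_def
  by (rule integral_cong_AE)
    (use assms in \<open>auto intro: borel_measurable_inner L2fun_measurable\<close>)

lemma L2_inner_nonneg: "0 \<le> L2_inner M f f"
  by (simp add: L2_inner_def)

lemma L2_norm_nonneg [simp]: "0 \<le> L2_norm M f"
  by (simp add: L2_norm_def L2_inner_nonneg)

lemma L2_norm_square: "(L2_norm M f)\<^sup>2 = L2_inner M f f"
  by (simp add: L2_norm_def L2_inner_nonneg)

lemma L2_norm_scaleR: "L2_norm M (\<lambda>x. c *\<^sub>R f x) = \<bar>c\<bar> * L2_norm M f"
  unfolding L2_norm_def L2_inner_scaleR_left L2_inner_scaleR_right
  by (simp add: real_sqrt_mult flip: mult.assoc)

lemma L2_norm_eq_0_iff: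
  assumes "f \<in> L2fun M"
  shows "L2_norm M f = 0 \<longleftrightarrow> (AE x in M. f x = 0)"
proof -
  have "L2_norm M f = 0 \<longleftrightarrow> (LINT x|M. f x \<bullet> f x) = 0"
    by (simp add: L2_norm_def L2_inner_def)
  also have "\<dots> \<longleftrightarrow> (AE x in M. f x \<bullet> f x = 0)"
    using assms by (intro integral_nonneg_eq_0_iff_AE L2fun_integrable_inner) auto
  finally show ?thesis by simp
qed

section \<open>Cauchy-Schwarz and the triangle inequality\<close>

text \<open>A nonnegative quadratic is in particular nonnegative at its minimiser
  \<open>- b / c\<close>. It is stated for bare reals because it serves twice: for the L2 inner
  product and for the form of a positive operator. In both \<open>c\<close> may be
  \<open>0\<close>.\<close>

lemma quadratic_discriminant_le:
  fixes a b c :: real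
  assumes "\<And>t. 0 \<le> a + 2 * t * b + t\<^sup>2 * c" and "0 \<le> c"
  shows "b\<^sup>2 \<le> a * c"
proof (cases "c = 0")
  case True
  have "b = 0"
  proof (rule ccontr)
    assume "b \<noteq> 0"
    \<comment> \<open>With \<open>c = 0\<close> the polynomial is affine in \<open>t\<close>, and
      this choice of \<open>t\<close> gives it the value \<open>- 1\<close>.\<close>
    then have "2 * (- (a + 1) / (2 * b)) * b = - (a + 1)" by simp
    then show False
      using assms(1)[of "- (a + 1) / (2 * b)"] True by simp
  qed
  with True show ?thesis by simp
next
  case False
  have "0 \<le> a + 2 * (- b / c) * b + (- b / c)\<^sup>2 * c" by (rule assms)
  also have "\<dots> = a - b\<^sup>2 / c" using False by (simp add: power2_eq_square field_simps)
  finally show ?thesis using False \<open>0 \<le> c\<close> by (simp add: field_simps)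
qed

lemma L2_Cauchy_Schwarz:
  assumes "f \<in> L2fun M" "g \<in> L2fun M"
  shows "\<bar>L2_inner M f g\<bar> \<le> L2_norm M f * L2_norm M g"
proof -
  have "(L2_inner M f g)\<^sup>2 \<le> L2_inner M f f * L2_inner M g g"
  proof (rule quadratic_discriminant_le)
    fix t :: real
    have "0 \<le> L2_inner M (\<lambda>x. f x + t *\<^sub>R g x) (\<lambda>x. f x + t *\<^sub>R g x)"
      by (rule L2_inner_nonneg)
    also have "\<dots> = L2_inner M f f + 2 * t * L2_inner M f g + t\<^sup>2 * L2_inner M g g"
      using assms by (simp add: L2_inner_add_left L2_inner_add_right L2fun_add L2fun_scaleR
          L2_inner_scaleR_left L2_inner_scaleR_right L2_inner_commute[of M g f]
          power2_eq_square algebra_simps)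
    finally show "0 \<le> L2_inner M f f + 2 * t * L2_inner M f g + t\<^sup>2 * L2_inner M g g" .
  qed (rule L2_inner_nonneg)
  then have "(L2_inner M f g)\<^sup>2 \<le> (L2_norm M f * L2_norm M g)\<^sup>2"
    by (simp add: power_mult_distrib L2_norm_square)
  then show ?thesis
    by (rule abs_le_square_iff[THEN iffD2, of _ "L2_norm M f * L2_norm M g", simplified])
qed

lemma L2_norm_triangle:
  assumes "f \<in> L2fun M" "g \<in> L2fun M"
  shows "L2_norm M (\<lambda>x. f x + g x) \<le> L2_norm M f + L2_norm M g"
proof (rule power2_le_imp_le)
  have "(L2_norm M (\<lambda>x. f x + g x))\<^sup>2 = (L2_norm M f)\<^sup>2 + 2 * L2_inner M f g + (L2_norm M g)\<^sup>2"
    using assms by (simp add: L2_norm_square L2_inner_add_left L2_inner_add_right L2fun_add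
        L2_inner_commute[of M g f])
  also have "\<dots> \<le> (L2_norm M f + L2_norm M g)\<^sup>2"
    using L2_Cauchy_Schwarz[OF assms] by (simp add: power2_sum)
  finally show "(L2_norm M (\<lambda>x. f x + g x))\<^sup>2 \<le> (L2_norm M f + L2_norm M g)\<^sup>2" .
qed simp

lemma L2_norm_diff_le:
  assumes "f \<in> L2fun M" "g \<in> L2fun M"
  shows "L2_norm M (\<lambda>x. f x - g x) \<le> L2_norm M f + L2_norm M g"
  using L2_norm_triangle[OF assms(1) L2fun_scaleR[OF assms(2), of "-1"]]
  L2_norm_scaleR[of M "-1" g] by simp

lemma L2_norm_sum_le:
  assumes "\<And>i. i \<in> I \<Longrightarrow> f i \<in> L2fun M"
  shows "L2_norm M (\<lambda>x. \<Sum>i\<in>I. f i x) \<le> (\<Sum>i\<in>I. L2_norm M (f i))"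
  using assms
proof (induction I rule: infinite_finite_induct)
  case (insert i I)
  have "L2_norm M (\<lambda>x. f i x + (\<Sum>i\<in>I. f i x)) \<le> L2_norm M (f i) + L2_norm M (\<lambda>x. \<Sum>i\<in>I. f i x)"
    using insert.prems by (intro L2_norm_triangle L2fun_sum) auto
  then show ?case using insert by simp
qed (auto simp: L2_norm_def L2_inner_def)

section \<open>Limits of geometrically dominated series\<close>

text \<open>The sum telescopes after multiplication by \<open>1 - q\<close>. The bound is free of
  \<open>K\<close>, so it persists when the upper end of a tail goes to infinity.\<close>

lemma sum_geometric_le:
  fixes q :: real
  assumes "0 \<le> q" "q < 1" "N \<le> K"
  shows "(\<Sum>n\<in>{N..<K}. q ^ n) \<le> q ^ N / (1 - q)"
proof -
  have "(1 - q) * (\<Sum>n\<in>{N..<K}. q ^ n) = q ^ N - q ^ K"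
    using assms(3)
  proof (induction K rule: dec_induct)
    case (step n)
    then show ?case
      by (simp only: sum.atLeastLessThan_Suc distrib_left) (simp add: left_diff_distrib)
  qed simp
  moreover have "0 \<le> q ^ K" using assms by simp
  ultimately show ?thesis
    using assms by (simp add: pos_le_divide_eq mult.commute)
qed

text \<open>Weighting the terms by \<open>1 / q ^ n\<close> turns the Cauchy-Schwarz inequality for sums into an
  integrable pointwise bound for all tails at once.\<close>
lemma L2fun_geometric_series_convergent:
  fixes d :: "nat \<Rightarrow> 'a \<Rightarrow> 'b::euclidean_space"
  assumes d: "\<And>n. d n \<in> L2fun M" and q: "0 < q" "q < 1"
    and le: "\<And>n. L2_norm M (d n) \<le> C * q ^ n"
  obtains f where "f \<in> L2fun M"
    "(\<lambda>N. L2_norm M (\<lambda>x. f x - (\<Sum>n<N. d n x))) \<longlonglongrightarrow> 0"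
proof -
  have [measurable]: "d n \<in> borel_measurable M" for n
    using d by (rule L2fun_measurable)
  define a where "a n x = (norm (d n x))\<^sup>2 / q ^ n" for n x
  have a0: "0 \<le> a n x" for n x using q by (simp add: a_def)
  have am[measurable]: "a n \<in> borel_measurable M" for n unfolding a_def by measurable
  have ai: "integrable M (a n)" for n
    using d[of n] unfolding a_def by (simp add: L2fun_def)
  \<comment> \<open>The squared norm is of order \<open>q ^ (2 * n)\<close>, so one factor
    \<open>q ^ n\<close> survives division by the weight.\<close>
  have ale: "(LINT x|M. a n x) \<le> C\<^sup>2 * q ^ n" for n
  proof -
    have "(LINT x|M. a n x) = (L2_norm M (d n))\<^sup>2 / q ^ n"
      by (simp add: a_def L2_norm_square L2_inner_def power2_norm_eq_inner)
    also have "\<dots> \<le> (C * q ^ n)\<^sup>2 / q ^ n"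
      using q le[of n] by (intro divide_right_mono power_mono) auto
    also have "\<dots> = C\<^sup>2 * q ^ n"
      using q by (simp add: power2_eq_square)
    finally show ?thesis .
  qed
  have sq: "summable (\<lambda>n. C\<^sup>2 * q ^ n)"
    using q by (intro summable_mult summable_geometric) auto
  have sI: "summable (\<lambda>n. LINT x|M. a n x)"
    by (rule summable_comparison_test[OF _ sq]) (use ale a0 in auto)
  \<comment> \<open>Sum and integral of nonnegative functions may be exchanged; the sum of the
    integrals is finite, hence the sum is finite almost everywhere.\<close>
  have AEs: "AE x in M. summable (\<lambda>n. a n x)"
  proof -
    have "(\<integral>\<^sup>+x. (\<Sum>n. ennreal (a n x)) \<partial>M) = (\<Sum>n. \<integral>\<^sup>+x. ennreal (a n x) \<partial>M)"
      by (rule nn_integral_suminf) measurable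
    also have "\<dots> = (\<Sum>n. ennreal (LINT x|M. a n x))"
      using ai a0 by (simp add: nn_integral_eq_integral)
    also have "\<dots> = ennreal (\<Sum>n. LINT x|M. a n x)"
      using sI a0 by (intro suminf_ennreal2) auto
    finally have "(\<integral>\<^sup>+x. (\<Sum>n. ennreal (a n x)) \<partial>M) \<noteq> \<infinity>" by simp
    then have "AE x in M. (\<Sum>n. ennreal (a n x)) \<noteq> \<infinity>"
      by (intro nn_integral_PInf_AE) measurable
    then show ?thesis
      using a0 by (auto elim!: eventually_mono intro: summable_suminf_not_top)
  qed
  define G where "G x = (\<Sum>n. a n x)" for x
  have Gi: "integrable M G"
    unfolding G_def using ai AEs sI a0 by (intro integrable_suminf) auto
  \<comment> \<open>Where the series diverges \<open>suminf\<close> has no specified value; such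
    points lie in the null set from \<open>AEs\<close>.\<close>
  define f where "f x = (\<Sum>n. d n x)" for x
  have fm[measurable]: "f \<in> borel_measurable M" unfolding f_def by measurable
  have bound: "AE x in M. (norm (f x - (\<Sum>n<N. d n x)))\<^sup>2 \<le> q ^ N / (1 - q) * G x" for N
    using AEs
  proof eventually_elim
    case (elim x)
    \<comment> \<open>This factorisation serves twice: AM-GM gives absolute convergence at
      \<open>x\<close>, and Cauchy-Schwarz bounds the tail by a geometric sum times
      \<open>G x\<close>.\<close>
    have wn: "norm (d n x) = sqrt (q ^ n) * sqrt (a n x)" for n
      using q by (simp add: a_def real_sqrt_divide)
    have "norm (d n x) \<le> q ^ n + a n x" for n
    proof -
      have "norm (d n x) \<le> (q ^ n + a n x) / 2"
        unfolding wn real_sqrt_mult[symmetric] using q a0 by (intro arith_geo_mean_sqrt) auto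
      moreover have "0 \<le> q ^ n + a n x" using q a0 by simp
      ultimately show ?thesis by simp
    qed
    then have "summable (\<lambda>n. norm (d n x))"
      by (intro summable_comparison_test[OF _ summable_add[OF summable_geometric elim]])
        (use q in auto)
    then have "summable (\<lambda>n. d n x)" by (rule summable_norm_cancel)
    then have lim: "(\<lambda>K. \<Sum>n<K. d n x) \<longlonglongrightarrow> f x"
      unfolding f_def by (rule summable_LIMSEQ)
    have "(norm ((\<Sum>n<K. d n x) - (\<Sum>n<N. d n x)))\<^sup>2 \<le> q ^ N / (1 - q) * G x" if "N \<le> K" for K
    proof -
      have "(\<Sum>n<K. d n x) - (\<Sum>n<N. d n x) = (\<Sum>n\<in>{N..<K}. d n x)"
        using that by (simp add: sum_diff_nat_ivl lessThan_atLeast0)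
      then have "(norm ((\<Sum>n<K. d n x) - (\<Sum>n<N. d n x)))\<^sup>2 \<le> (\<Sum>n\<in>{N..<K}. norm (d n x))\<^sup>2"
        by (simp add: norm_sum power_mono)
      also have "\<dots> \<le> (\<Sum>n\<in>{N..<K}. (sqrt (q ^ n))\<^sup>2) * (\<Sum>n\<in>{N..<K}. (sqrt (a n x))\<^sup>2)"
        unfolding wn by (rule Cauchy_Schwarz_ineq_sum)
      also have "\<dots> = (\<Sum>n\<in>{N..<K}. q ^ n) * (\<Sum>n\<in>{N..<K}. a n x)"
        using q a0 by simp
      also have "\<dots> \<le> q ^ N / (1 - q) * G x"
      proof (rule mult_mono)
        show "(\<Sum>n\<in>{N..<K}. q ^ n) \<le> q ^ N / (1 - q)"
          using q that by (intro sum_geometric_le) auto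
        show "(\<Sum>n\<in>{N..<K}. a n x) \<le> G x"
          unfolding G_def using elim a0 by (intro sum_le_suminf) auto
      qed (use q a0 in \<open>auto intro: sum_nonneg\<close>)
      finally show ?thesis .
    qed
    then have "eventually (\<lambda>K. (norm ((\<Sum>n<K. d n x) - (\<Sum>n<N. d n x)))\<^sup>2 \<le> q ^ N / (1 - q) * G x) sequentially"
      by (auto simp: eventually_sequentially)
    moreover have "(\<lambda>K. (norm ((\<Sum>n<K. d n x) - (\<Sum>n<N. d n x)))\<^sup>2) \<longlonglongrightarrow> (norm (f x - (\<Sum>n<N. d n x)))\<^sup>2"
      by (intro tendsto_intros lim)
    ultimately show ?case
      by (intro tendsto_upperbound) auto
  qed
  have fL: "f \<in> L2fun M"
  proof -
    have "integrable M (\<lambda>x. (norm (f x))\<^sup>2)"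
    proof (rule Bochner_Integration.integrable_bound)
      show "integrable M (\<lambda>x. 1 / (1 - q) * G x)" using Gi by simp
      \<comment> \<open>The case \<open>N = 0\<close> of the tail bound dominates \<open>f\<close>
        itself.\<close>
      show "AE x in M. norm ((norm (f x))\<^sup>2) \<le> norm (1 / (1 - q) * G x)"
        using bound[of 0]
      proof eventually_elim
        case (elim x)
        then have "(norm (f x))\<^sup>2 \<le> 1 / (1 - q) * G x" by simp
        then show ?case
          unfolding real_norm_def abs_power2 by (rule order_trans[OF _ abs_ge_self])
      qed
    qed measurable
    then show ?thesis by (simp add: L2fun_def)
  qed
  have le2: "(L2_norm M (\<lambda>x. f x - (\<Sum>n<N. d n x)))\<^sup>2 \<le> q ^ N * ((LINT x|M. G x) / (1 - q))" for N
  proof -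
    have g: "(\<lambda>x. f x - (\<Sum>n<N. d n x)) \<in> L2fun M"
      by (intro L2fun_diff fL L2fun_sum d)
    have "(LINT x|M. (norm (f x - (\<Sum>n<N. d n x)))\<^sup>2) \<le> (LINT x|M. q ^ N / (1 - q) * G x)"
      using g Gi bound[of N] by (intro integral_mono_AE) (auto simp: L2fun_def)
    then show ?thesis
      by (simp add: L2_norm_square L2_inner_def power2_norm_eq_inner)
  qed
  have "(\<lambda>N. q ^ N * ((LINT x|M. G x) / (1 - q))) \<longlonglongrightarrow> 0"
    using q by (intro tendsto_mult_left_zero LIMSEQ_power_zero) auto
  then have "(\<lambda>N. (L2_norm M (\<lambda>x. f x - (\<Sum>n<N. d n x)))\<^sup>2) \<longlonglongrightarrow> 0"
    by (rule Lim_null_comparison[OF always_eventually[OF allI], rotated])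
      (simp only: real_norm_def abs_power2 le2)
  then have "(\<lambda>N. sqrt ((L2_norm M (\<lambda>x. f x - (\<Sum>n<N. d n x)))\<^sup>2)) \<longlonglongrightarrow> sqrt 0"
    by (rule tendsto_real_sqrt)
  then show ?thesis using that fL by simp
qed

section \<open>Bounded operators\<close>

text \<open>The real-scalar counterpart of \<open>bounded_op\<close>. Operators act on
  representatives rather than on classes, so each algebraic law holds only up to null sets.\<close>

definition L2_bounded_linear ::
  "'a measure \<Rightarrow> (('a \<Rightarrow> 'b::euclidean_space) \<Rightarrow> ('a \<Rightarrow> 'b)) \<Rightarrow> bool" where
  "L2_bounded_linear M U \<longleftrightarrow>
     (\<forall>f\<in>L2fun M. U f \<in> L2fun M) \<and>
     (\<forall>f\<in>L2fun M. \<forall>g\<in>L2fun M. (AE x in M. f x = g x) \<longrightarrow> (AE x in M. U f x = U g x)) \<and>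
     (\<forall>f\<in>L2fun M. \<forall>g\<in>L2fun M. AE x in M. U (\<lambda>x. f x + g x) x = U f x + U g x) \<and>
     (\<forall>f\<in>L2fun M. \<forall>c. AE x in M. U (\<lambda>x. c *\<^sub>R f x) x = c *\<^sub>R U f x) \<and>
     (\<exists>C. \<forall>f\<in>L2fun M. L2_norm M (U f) \<le> C * L2_norm M f)"

context
  fixes M :: "'a measure" and U :: "('a \<Rightarrow> 'b::euclidean_space) \<Rightarrow> ('a \<Rightarrow> 'b)"
  assumes U: "L2_bounded_linear M U"
begin

lemma L2_bounded_linear_closed: "f \<in> L2fun M \<Longrightarrow> U f \<in> L2fun M"
  using U by (simp add: L2_bounded_linear_def)

lemma L2_bounded_linear_add:
  "f \<in> L2fun M \<Longrightarrow> g \<in> L2fun M \<Longrightarrow> AE x in M. U (\<lambda>x. f x + g x) x = U f x + U g x"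
  using U by (simp add: L2_bounded_linear_def)

lemma L2_bounded_linear_scaleR:
  "f \<in> L2fun M \<Longrightarrow> AE x in M. U (\<lambda>x. c *\<^sub>R f x) x = c *\<^sub>R U f x"
  using U by (simp add: L2_bounded_linear_def)

text \<open>Any bound can be enlarged. The freedom in \<open>B\<close> lets the Neumann series use a
  constant above the coercivity constant, which keeps the contraction factor positive.\<close>

lemma L2_bounded_linear_bound:
  obtains C where "B \<le> C" "0 < C" "\<And>f. f \<in> L2fun M \<Longrightarrow> L2_norm M (U f) \<le> C * L2_norm M f"
proof -
  obtain C where C: "\<And>f. f \<in> L2fun M \<Longrightarrow> L2_norm M (U f) \<le> C * L2_norm M f"
    using U unfolding L2_bounded_linear_def by blast
  have "L2_norm M (U f) \<le> max (max B C) 1 * L2_norm M f" if "f \<in> L2fun M" for f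
    by (rule order_trans[OF C[OF that] mult_right_mono]) auto
  then show ?thesis
    by (intro that[of "max (max B C) 1"]) auto
qed

lemma L2_bounded_linear_diff:
  assumes "f \<in> L2fun M" "g \<in> L2fun M"
  shows "AE x in M. U (\<lambda>x. f x - g x) x = U f x - U g x"
  using L2_bounded_linear_add[OF assms(1) L2fun_scaleR[OF assms(2), of "-1"]]
    L2_bounded_linear_scaleR[OF assms(2), of "-1"]
  by eventually_elim simp

lemma L2_bounded_linear_sum:
  fixes N :: nat
  assumes "\<And>n. d n \<in> L2fun M"
  shows "AE x in M. U (\<lambda>x. \<Sum>n<N. d n x) x = (\<Sum>n<N. U (d n) x)"
proof (induction N)
  case 0
  \<comment> \<open>The empty sum is the zero function, and homogeneity with factor \<open>0\<close>
    shows that \<open>U\<close> maps it to zero.\<close>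
  show ?case using L2_bounded_linear_scaleR[OF L2fun_zero, of 0] by simp
next
  case (Suc N)
  have "AE x in M. U (\<lambda>x. (\<Sum>n<N. d n x) + d N x) x = U (\<lambda>x. \<Sum>n<N. d n x) x + U (d N) x"
    using assms by (intro L2_bounded_linear_add L2fun_sum)
  with Suc show ?case by eventually_elim simp
qed

end

section \<open>Coercivity, surjectivity and lower bounds\<close>

lemma L2_norm_cong_AE:
  assumes "f \<in> L2fun M" "g \<in> L2fun M" "AE x in M. f x = g x"
  shows "L2_norm M f = L2_norm M g"
  unfolding L2_norm_def using L2_inner_cong_AE[OF assms(1,2) assms(1,2) assms(3) assms(3)] by simp

text \<open>With \<open>\<alpha> = m / C\<^sup>2\<close> the map \<open>f \<mapsto> f - \<alpha> P f\<close> is a strict contraction, so \<open>P\<close> is inverted by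
  a Neumann series.\<close>
lemma coercive_imp_surj:
  assumes P: "L2_bounded_linear M P" and m: "0 < m"
    and coercive: "\<And>f. f \<in> L2fun M \<Longrightarrow> m * (L2_norm M f)\<^sup>2 \<le> L2_inner M (P f) f"
    and h: "h \<in> L2fun M"
  shows "\<exists>f\<in>L2fun M. AE x in M. P f x = h x"
proof -
  obtain C where C: "2 * m \<le> C" "0 < C" and bd: "\<And>f. f \<in> L2fun M \<Longrightarrow> L2_norm M (P f) \<le> C * L2_norm M f"
    using L2_bounded_linear_bound[OF P, of "2 * m"] by auto
  \<comment> \<open>This value minimises
    \<open>1 - 2 * \<alpha> * m + \<alpha>\<^sup>2 * C\<^sup>2\<close>, the bound for the squared
    contraction factor; the minimum is \<open>1 - m\<^sup>2 / C\<^sup>2\<close>.\<close>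
  define \<alpha> where "\<alpha> = m / C\<^sup>2"
  have \<alpha>: "0 < \<alpha>" using m C by (simp add: \<alpha>_def)
  define q where "q = sqrt (1 - m\<^sup>2 / C\<^sup>2)"
  have "m\<^sup>2 < C\<^sup>2" using m C by (intro power_strict_mono) auto
  then have q: "0 < q" "q < 1" using m C by (auto simp: q_def)
  have q2: "q\<^sup>2 = 1 - m\<^sup>2 / C\<^sup>2" using \<open>m\<^sup>2 < C\<^sup>2\<close> C by (simp add: q_def)
  define K where "K f x = f x - \<alpha> *\<^sub>R P f x" for f x
  have KL: "K f \<in> L2fun M" if "f \<in> L2fun M" for f
    unfolding K_def using that by (intro L2fun_diff L2fun_scaleR L2_bounded_linear_closed[OF P])
  have contr: "L2_norm M (K f) \<le> q * L2_norm M f" if f: "f \<in> L2fun M" for f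
  proof (rule power2_le_imp_le)
    have Pf: "P f \<in> L2fun M" by (rule L2_bounded_linear_closed[OF P f])
    have "(L2_norm M (K f))\<^sup>2
      = (L2_norm M f)\<^sup>2 - 2 * \<alpha> * L2_inner M (P f) f + \<alpha>\<^sup>2 * (L2_norm M (P f))\<^sup>2"
      unfolding K_def L2_norm_square using f Pf
      by (simp add: L2_inner_diff_left L2_inner_diff_right L2fun_diff L2fun_scaleR
          L2_inner_scaleR_left L2_inner_scaleR_right L2_inner_commute[of M f "P f"]
          power2_eq_square algebra_simps)
    also have "\<dots> \<le> (L2_norm M f)\<^sup>2 - 2 * \<alpha> * (m * (L2_norm M f)\<^sup>2) + \<alpha>\<^sup>2 * (C * L2_norm M f)\<^sup>2"
      using \<alpha> coercive[OF f] bd[OF f]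
      by (intro add_mono diff_mono mult_left_mono power_mono order_refl) auto
    also have "\<dots> = (1 - m\<^sup>2 / C\<^sup>2) * (L2_norm M f)\<^sup>2"
      using C by (simp add: \<alpha>_def power2_eq_square field_simps)
    also have "\<dots> = (q * L2_norm M f)\<^sup>2"
      by (simp only: power_mult_distrib q2)
    finally show "(L2_norm M (K f))\<^sup>2 \<le> (q * L2_norm M f)\<^sup>2" .
  qed (use q in simp)
  \<comment> \<open>These are the terms of the Neumann series for
    \<open>\<alpha> P f = \<alpha> h\<close>, where \<open>\<alpha> P\<close> is the identity minus
    \<open>K\<close>.\<close>
  define d where "d n = (K ^^ n) (\<lambda>x. \<alpha> *\<^sub>R h x)" for n
  have dL: "d n \<in> L2fun M" for n
    unfolding d_def by (induction n) (auto intro: KL L2fun_scaleR h)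
  have dn: "L2_norm M (d n) \<le> L2_norm M (d 0) * q ^ n" for n
  proof (induction n)
    case (Suc n)
    have "L2_norm M (d (Suc n)) \<le> q * L2_norm M (d n)"
      using contr[OF dL[of n]] by (simp add: d_def)
    also have "\<dots> \<le> q * (L2_norm M (d 0) * q ^ n)"
      using Suc q by (intro mult_left_mono) auto
    finally show ?case by (simp add: ac_simps)
  qed simp
  obtain f where f: "f \<in> L2fun M"
    and lim: "(\<lambda>N. L2_norm M (\<lambda>x. f x - (\<Sum>n<N. d n x))) \<longlonglongrightarrow> 0"
    using L2fun_geometric_series_convergent[OF dL q dn] by blast
  have PL: "P g \<in> L2fun M" if "g \<in> L2fun M" for g
    using that by (rule L2_bounded_linear_closed[OF P])
  let ?R = "\<lambda>N x. f x - (\<Sum>n<N. d n x)"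
  have RL: "?R N \<in> L2fun M" for N by (intro L2fun_diff f L2fun_sum dL)
  let ?r = "\<lambda>x. \<alpha> *\<^sub>R P f x - \<alpha> *\<^sub>R h x"
  have rL: "?r \<in> L2fun M" by (intro L2fun_diff L2fun_scaleR PL f h)
  \<comment> \<open>\<open>P\<close> is moved only through finite sums: there
    \<open>\<alpha> P = I - K\<close> telescopes to \<open>d 0 - d N\<close> with
    \<open>d 0 = \<alpha> h\<close>, and the remainder of the series is controlled by the bound for
    \<open>P\<close>.\<close>
  have "L2_norm M ?r \<le> \<alpha> * C * L2_norm M (?R N) + L2_norm M (d 0) * q ^ N" for N
  proof -
    have "AE x in M. P (?R N) x = P f x - P (\<lambda>x. \<Sum>n<N. d n x) x"
      by (intro L2_bounded_linear_diff[OF P] f L2fun_sum dL)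
    moreover have "AE x in M. P (\<lambda>x. \<Sum>n<N. d n x) x = (\<Sum>n<N. P (d n) x)"
      by (intro L2_bounded_linear_sum[OF P] dL)
    ultimately have "AE x in M. ?r x = \<alpha> *\<^sub>R P (?R N) x - d N x"
    proof eventually_elim
      case (elim x)
      have "\<alpha> *\<^sub>R (\<Sum>n<N. P (d n) x) = (\<Sum>n<N. d n x - d (Suc n) x)"
        by (simp add: scaleR_sum_right d_def K_def)
      also have "\<dots> = d 0 x - d N x"
        by (rule sum_lessThan_telescope')
      finally show ?case using elim by (simp add: d_def scaleR_diff_right)
    qed
    then have "L2_norm M ?r = L2_norm M (\<lambda>x. \<alpha> *\<^sub>R P (?R N) x - d N x)"
      by (intro L2_norm_cong_AE rL L2fun_diff L2fun_scaleR PL RL dL)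
    also have "\<dots> \<le> L2_norm M (\<lambda>x. \<alpha> *\<^sub>R P (?R N) x) + L2_norm M (d N)"
      by (intro L2_norm_diff_le L2fun_scaleR PL RL dL)
    also have "\<dots> \<le> \<alpha> * (C * L2_norm M (?R N)) + L2_norm M (d 0) * q ^ N"
      unfolding L2_norm_scaleR using \<alpha> bd[OF RL] dn by (intro add_mono mult_mono) auto
    finally show ?thesis by (simp add: mult.assoc)
  qed
  moreover have "(\<lambda>N. \<alpha> * C * L2_norm M (?R N) + L2_norm M (d 0) * q ^ N) \<longlonglongrightarrow> \<alpha> * C * 0 + L2_norm M (d 0) * 0"
    using q by (intro tendsto_intros lim LIMSEQ_power_zero) auto
  ultimately have "L2_norm M ?r \<le> \<alpha> * C * 0 + L2_norm M (d 0) * 0"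
    by (intro tendsto_lowerbound) auto
  then have "L2_norm M ?r = 0" using L2_norm_nonneg[of M ?r] by simp
  then have "AE x in M. ?r x = 0" using rL by (simp add: L2_norm_eq_0_iff)
  then have "AE x in M. P f x = h x" by eventually_elim (use \<alpha> in simp)
  with f show ?thesis by blast
qed

text \<open>Otherwise there are unit vectors \<open>u n\<close> with \<open>\<parallel>W (u n)\<parallel> < 1 / 9 ^ n\<close>. The signs in
  \<open>h = (\<Sum>n. \<plusminus> u n / 3 ^ n)\<close> can be chosen such that \<open>\<bar>\<langle>u n, h\<rangle>\<bar> \<ge> 1 / (2 * 3 ^ n)\<close>, whereas \<open>h = V g\<close>
  gives \<open>\<bar>\<langle>u n, h\<rangle>\<bar> \<le> \<parallel>g\<parallel> / 9 ^ n\<close>. This replaces the open mapping theorem.\<close>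
lemma surj_imp_adjoint_bounded_below:
  assumes V: "\<And>f. f \<in> L2fun M \<Longrightarrow> V f \<in> L2fun M"
    and surj: "\<And>h. h \<in> L2fun M \<Longrightarrow> \<exists>g\<in>L2fun M. AE x in M. V g x = h x"
    and W: "L2_bounded_linear M W"
    and adj: "\<And>f g. f \<in> L2fun M \<Longrightarrow> g \<in> L2fun M \<Longrightarrow> L2_inner M (V f) g = L2_inner M f (W g)"
  shows "\<exists>c>0. \<forall>f\<in>L2fun M. c * L2_norm M f \<le> L2_norm M (W f)"
proof (rule ccontr)
  assume neg: "\<not> (\<exists>c>0. \<forall>f\<in>L2fun M. c * L2_norm M f \<le> L2_norm M (W f))"
  have "\<exists>u\<in>L2fun M. L2_norm M u = 1 \<and> L2_norm M (W u) < (1/9) ^ n" for n :: nat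
  proof -
    have "\<not> (\<forall>f\<in>L2fun M. (1/9) ^ n * L2_norm M f \<le> L2_norm M (W f))"
      using neg by (meson zero_less_power zero_less_divide_1_iff zero_less_numeral)
    then obtain f where f: "f \<in> L2fun M" and lt: "L2_norm M (W f) < (1/9) ^ n * L2_norm M f"
      by (auto simp: not_le)
    have "0 < L2_norm M f"
      using lt L2_norm_nonneg[of M f] L2_norm_nonneg[of M "W f"]
      by (cases "L2_norm M f = 0") (auto simp del: L2_norm_nonneg)
    let ?u = "\<lambda>x. (1 / L2_norm M f) *\<^sub>R f x"
    have u: "?u \<in> L2fun M" by (rule L2fun_scaleR[OF f])
    have "L2_norm M (W ?u) = L2_norm M (\<lambda>x. (1 / L2_norm M f) *\<^sub>R W f x)"
      by (intro L2_norm_cong_AE L2_bounded_linear_scaleR[OF W] f u L2fun_scaleR L2_bounded_linear_closed[OF W])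
    also have "\<dots> = L2_norm M (W f) / L2_norm M f"
      using \<open>0 < L2_norm M f\<close> by (simp add: L2_norm_scaleR)
    also have "\<dots> < (1/9) ^ n"
      using lt \<open>0 < L2_norm M f\<close> by (simp add: field_simps)
    finally have "L2_norm M (W ?u) < (1/9) ^ n" .
    moreover have "L2_norm M ?u = 1"
      using \<open>0 < L2_norm M f\<close> by (simp add: L2_norm_scaleR)
    ultimately show ?thesis using u by blast
  qed
  then obtain u where uL: "\<And>n. u n \<in> L2fun M" and u1: "\<And>n. L2_norm M (u n) = 1"
    and Wu: "\<And>n. L2_norm M (W (u n)) < (1/9) ^ n"
    by metis
  \<comment> \<open>Unlike \<open>sgn\<close>, this sign is \<open>1\<close> at \<open>0\<close>, so
    for \<open>r \<ge> 0\<close> the modulus of \<open>t + \<sigma> t * r\<close> is always at least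
    \<open>r\<close>.\<close>
  define \<sigma> :: "real \<Rightarrow> real" where "\<sigma> t = (if 0 \<le> t then 1 else - 1)" for t
  \<comment> \<open>Each sign depends on the partial sum before it, so the partial sums are built by
    recursion first and the terms are read off from them.\<close>
  define S where "S = rec_nat (\<lambda>x. 0) (\<lambda>n g x. g x + (\<sigma> (L2_inner M (u n) g) * (1/3) ^ n) *\<^sub>R u n x)"
  define s where "s n = \<sigma> (L2_inner M (u n) (S n)) * (1/3) ^ n" for n
  define d where "d n x = s n *\<^sub>R u n x" for n x
  have S: "S n = (\<lambda>x. \<Sum>k<n. d k x)" for n
    by (induction n) (simp_all add: S_def d_def s_def)
  have dL: "d n \<in> L2fun M" for n unfolding d_def by (rule L2fun_scaleR[OF uL])
  have SL: "S n \<in> L2fun M" for n unfolding S by (rule L2fun_sum[OF dL])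
  have abs_s: "\<bar>s n\<bar> = (1/3) ^ n" for n by (simp add: s_def \<sigma>_def abs_mult)
  have dn: "L2_norm M (d n) = (1/3) ^ n" for n
    unfolding d_def L2_norm_scaleR by (simp add: abs_s u1)
  obtain h where h: "h \<in> L2fun M"
    and lim: "(\<lambda>N. L2_norm M (\<lambda>x. h x - (\<Sum>n<N. d n x))) \<longlonglongrightarrow> 0"
    by (rule L2fun_geometric_series_convergent[OF dL, where q = "1/3" and C = 1]) (auto simp: dn)
  \<comment> \<open>The new summand contributes with the sign of
    \<open>L2_inner M (u n) (S n)\<close>, so the two cannot cancel.\<close>
  have uS: "(1/3) ^ n \<le> \<bar>L2_inner M (u n) (S (Suc n))\<bar>" for n
  proof -
    have "L2_inner M (u n) (S (Suc n)) = L2_inner M (u n) (S n) + s n"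
    proof -
      have "S (Suc n) = (\<lambda>x. S n x + s n *\<^sub>R u n x)" by (simp add: S d_def)
      then show ?thesis
        using SL[of n] uL[of n] u1[of n] L2_norm_square[of M "u n"]
        by (simp add: L2_inner_add_right L2fun_scaleR L2_inner_scaleR_right)
    qed
    then show ?thesis
      using zero_le_power[of "1/3::real" n] by (auto simp: s_def \<sigma>_def)
  qed
  \<comment> \<open>With ratio \<open>1/3\<close> everything after index \<open>n\<close> has norm
    at most half of that of the term at \<open>n\<close>, so the rest of the series cannot undo
    \<open>uS\<close>.\<close>
  have tail: "L2_norm M (\<lambda>x. h x - S (Suc n) x) \<le> (1/3) ^ n / 2" for n
  proof -
    have "L2_norm M (\<lambda>x. h x - S (Suc n) x) \<le> (1/3) ^ n / 2 + L2_norm M (\<lambda>x. h x - (\<Sum>k<N. d k x))"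
      if N: "Suc n \<le> N" for N
    proof -
      have eq: "h x - S (Suc n) x = (\<Sum>k\<in>{Suc n..<N}. d k x) + (h x - (\<Sum>k<N. d k x))" for x
      proof -
        have "(\<Sum>k<N. d k x) - (\<Sum>k<Suc n. d k x) = (\<Sum>k\<in>{Suc n..<N}. d k x)"
          using N by (simp only: lessThan_atLeast0 sum_diff_nat_ivl)
        then show ?thesis by (simp add: S algebra_simps)
      qed
      have "L2_norm M (\<lambda>x. h x - S (Suc n) x)
        \<le> L2_norm M (\<lambda>x. \<Sum>k\<in>{Suc n..<N}. d k x) + L2_norm M (\<lambda>x. h x - (\<Sum>k<N. d k x))"
        unfolding eq by (intro L2_norm_triangle L2fun_diff L2fun_sum dL h)
      moreover have "L2_norm M (\<lambda>x. \<Sum>k\<in>{Suc n..<N}. d k x) \<le> (\<Sum>k\<in>{Suc n..<N}. (1/3) ^ k)"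
        using L2_norm_sum_le[of "{Suc n..<N}" d M] dL by (simp add: dn)
      moreover have "(\<Sum>k\<in>{Suc n..<N}. (1/3::real) ^ k) \<le> (1/3) ^ n / 2"
        using sum_geometric_le[of "1/3" "Suc n" N] N by simp
      ultimately show ?thesis by linarith
    qed
    then have ev: "eventually (\<lambda>N. L2_norm M (\<lambda>x. h x - S (Suc n) x)
        \<le> (1/3) ^ n / 2 + L2_norm M (\<lambda>x. h x - (\<Sum>k<N. d k x))) sequentially"
      by (auto simp: eventually_sequentially)
    have lim2: "(\<lambda>N. (1/3) ^ n / 2 + L2_norm M (\<lambda>x. h x - (\<Sum>k<N. d k x))) \<longlonglongrightarrow> (1/3) ^ n / 2 + 0"
      by (intro tendsto_intros lim)
    show ?thesis
      using tendsto_lowerbound[OF lim2 ev] by simp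
  qed
  obtain g where g: "g \<in> L2fun M" and Vg: "AE x in M. V g x = h x"
    using surj[OF h] by blast
  have key: "3 ^ n \<le> 2 * L2_norm M g" for n :: nat
  proof -
    have "\<bar>L2_inner M (u n) h\<bar> = \<bar>L2_inner M g (W (u n))\<bar>"
      using adj[OF g uL] L2_inner_cong_AE[OF V[OF g] h uL uL Vg AE_I2[OF refl]] L2_inner_commute[of M h "u n"]
      by simp
    also have "\<dots> \<le> L2_norm M g * L2_norm M (W (u n))"
      by (intro L2_Cauchy_Schwarz g L2_bounded_linear_closed[OF W] uL)
    also have "\<dots> \<le> L2_norm M g * (1/9) ^ n"
      using Wu[of n] by (intro mult_left_mono) auto
    finally have 1: "\<bar>L2_inner M (u n) h\<bar> \<le> L2_norm M g * (1/9) ^ n" .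
    have "\<bar>L2_inner M (u n) h - L2_inner M (u n) (S (Suc n))\<bar> = \<bar>L2_inner M (u n) (\<lambda>x. h x - S (Suc n) x)\<bar>"
      by (simp add: L2_inner_diff_right[OF h SL uL])
    also have "\<dots> \<le> L2_norm M (u n) * L2_norm M (\<lambda>x. h x - S (Suc n) x)"
      by (intro L2_Cauchy_Schwarz uL L2fun_diff h SL)
    also have "\<dots> \<le> (1/3) ^ n / 2" using tail[of n] by (simp add: u1)
    finally have "(1/3) ^ n / 2 \<le> L2_norm M g * (1/9) ^ n"
      using 1 uS[of n] by linarith
    moreover have "(9::real) ^ n = 3 ^ n * 3 ^ n" by (simp flip: power_mult_distrib)
    ultimately show ?thesis by (simp add: power_one_over field_simps)
  qed
  obtain n :: nat where "2 * L2_norm M g < 3 ^ n"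
    using real_arch_pow[of 3] by auto
  with key[of n] show False by simp
qed

text \<open>The form \<open>L2_inner M (P f) g\<close> is symmetric and nonnegative, so it obeys
  Cauchy-Schwarz. With \<open>g = P f\<close> this bounds the fourth power of
  \<open>\<parallel>P f\<parallel>\<close> by
  \<open>\<langle>P f, f\<rangle> \<langle>P g, g\<rangle>\<close>, whose last factor is at most
  \<open>C \<parallel>P f\<parallel>\<^sup>2\<close>. Cancelling yields
  \<open>m = c\<^sup>2 / C\<close> without a square root of \<open>P\<close>.\<close>

lemma positive_bounded_below_imp_coercive:
  assumes P: "L2_bounded_linear M P"
    and sym: "\<And>f g. f \<in> L2fun M \<Longrightarrow> g \<in> L2fun M \<Longrightarrow> L2_inner M (P f) g = L2_inner M f (P g)"
    and pos: "\<And>f. f \<in> L2fun M \<Longrightarrow> 0 \<le> L2_inner M (P f) f"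
    and c: "0 < c" and below: "\<And>f. f \<in> L2fun M \<Longrightarrow> c * L2_norm M f \<le> L2_norm M (P f)"
  obtains m where "0 < m" "\<And>f. f \<in> L2fun M \<Longrightarrow> m * (L2_norm M f)\<^sup>2 \<le> L2_inner M (P f) f"
proof -
  obtain C where C: "0 < C" and bd: "\<And>f. f \<in> L2fun M \<Longrightarrow> L2_norm M (P f) \<le> C * L2_norm M f"
    using L2_bounded_linear_bound[OF P] by metis
  have "c\<^sup>2 / C * (L2_norm M f)\<^sup>2 \<le> L2_inner M (P f) f" if f: "f \<in> L2fun M" for f
  proof -
    have PL: "P g \<in> L2fun M" if "g \<in> L2fun M" for g
      using that by (rule L2_bounded_linear_closed[OF P])
    let ?g = "P f"
    have g: "?g \<in> L2fun M" by (rule PL[OF f])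
    have "(L2_inner M (P f) ?g)\<^sup>2 \<le> L2_inner M (P f) f * L2_inner M (P ?g) ?g"
    proof (rule quadratic_discriminant_le)
      fix t :: real
      let ?h = "\<lambda>x. f x + t *\<^sub>R ?g x"
      have h: "?h \<in> L2fun M" by (intro L2fun_add L2fun_scaleR f g)
      have "AE x in M. P ?h x = P f x + t *\<^sub>R P ?g x"
        using L2_bounded_linear_add[OF P f L2fun_scaleR[OF g, of t]] L2_bounded_linear_scaleR[OF P g, of t]
        by eventually_elim simp
      then have "L2_inner M (P ?h) ?h = L2_inner M (\<lambda>x. P f x + t *\<^sub>R P ?g x) ?h"
        by (intro L2_inner_cong_AE PL h L2fun_add L2fun_scaleR f g) auto
      also have "\<dots> = L2_inner M (P f) f + 2 * t * L2_inner M (P f) ?g + t\<^sup>2 * L2_inner M (P ?g) ?g"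
        using f g PL[OF g] sym[OF g f]
        by (simp add: L2_inner_add_left L2_inner_add_right L2fun_add L2fun_scaleR
          L2_inner_scaleR_left L2_inner_scaleR_right L2_inner_commute[of M f]
          power2_eq_square algebra_simps)
      finally show "0 \<le> L2_inner M (P f) f + 2 * t * L2_inner M (P f) ?g + t\<^sup>2 * L2_inner M (P ?g) ?g"
        using pos[OF h] by simp
    qed (rule pos[OF g])
    also have "\<dots> \<le> L2_inner M (P f) f * (C * (L2_norm M ?g)\<^sup>2)"
    proof (intro mult_left_mono pos f)
      have "L2_inner M (P ?g) ?g \<le> L2_norm M (P ?g) * L2_norm M ?g"
        using L2_Cauchy_Schwarz[OF PL[OF g] g] by simp
      also have "\<dots> \<le> C * L2_norm M ?g * L2_norm M ?g"
        by (intro mult_right_mono bd g) simp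
      finally show "L2_inner M (P ?g) ?g \<le> C * (L2_norm M ?g)\<^sup>2"
        by (simp add: power2_eq_square)
    qed
    finally have *: "(L2_norm M ?g)\<^sup>2 * (L2_norm M ?g)\<^sup>2 \<le> C * L2_inner M (P f) f * (L2_norm M ?g)\<^sup>2"
      by (simp add: power2_eq_square L2_norm_square[symmetric] ac_simps)
    have "(L2_norm M ?g)\<^sup>2 \<le> C * L2_inner M (P f) f"
    proof (cases "L2_norm M ?g = 0")
      case True
      then show ?thesis using pos[OF f] C by simp
    next
      case False
      then show ?thesis using mult_right_le_imp_le[OF *] by simp
    qed
    moreover have "c\<^sup>2 * (L2_norm M f)\<^sup>2 \<le> (L2_norm M ?g)\<^sup>2"
      unfolding power_mult_distrib[symmetric] using below[OF f] c by (intro power_mono) auto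
    ultimately show ?thesis using C by (simp add: field_simps)
  qed
  with c C show ?thesis by (intro that[of "c\<^sup>2 / C"]) auto
qed

section \<open>Matrix-valued functions\<close>

lemma integrable_mult_cnj:
  assumes "f \<in> L2m M" "g \<in> L2m M"
  shows "integrable M (\<lambda>x. f x $ i $ k * cnj (g x $ j $ k))"
proof (rule Bochner_Integration.integrable_bound)
  show "integrable M (\<lambda>x. (cmod (f x $ i $ k))\<^sup>2 + (cmod (g x $ j $ k))\<^sup>2)"
    using assms by (auto simp: L2m_def)
  have [measurable]: "(\<lambda>x. f x $ i $ k) \<in> borel_measurable M" "(\<lambda>x. g x $ j $ k) \<in> borel_measurable M"
    using assms by (auto simp: L2m_def)
  have "(\<lambda>x. cnj (g x $ j $ k)) \<in> borel_measurable M"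
    by (rule borel_measurable_continuous_on[of cnj]) (auto intro: continuous_intros)
  then show "(\<lambda>x. f x $ i $ k * cnj (g x $ j $ k)) \<in> borel_measurable M"
    by measurable
  have "cmod a * cmod b \<le> (cmod a)\<^sup>2 + (cmod b)\<^sup>2" for a b
    using sum_squares_bound[of "cmod a" "cmod b"]
      mult_nonneg_nonneg[OF norm_ge_zero[of a] norm_ge_zero[of b]] by linarith
  then show "AE x in M. norm (f x $ i $ k * cnj (g x $ j $ k))
      \<le> norm ((cmod (f x $ i $ k))\<^sup>2 + (cmod (g x $ j $ k))\<^sup>2)"
    by (simp add: norm_mult)
qed

lemma minner_nth:
  assumes "f \<in> L2m M" "g \<in> L2m M"
  shows "minner M f g $ i $ j = (\<Sum>k\<in>UNIV. LINT x|M. f x $ i $ k * cnj (g x $ j $ k))"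
  unfolding minner_def using assms by (simp add: integrable_mult_cnj)

lemma inner_matrix: "A \<bullet> B = (\<Sum>i\<in>UNIV. \<Sum>k\<in>UNIV. Re (A $ i $ k * cnj (B $ i $ k)))"
  for A B :: "complex^'r^'s"
  by (simp add: inner_vec_def inner_complex_def)

lemma norm_matrix_square: "(norm A)\<^sup>2 = (\<Sum>i\<in>UNIV. \<Sum>k\<in>UNIV. (cmod (A $ i $ k))\<^sup>2)"
  for A :: "complex^'r^'s"
  by (simp add: power2_norm_eq_inner inner_vec_def)

text \<open>The squared Euclidean norm of a matrix is the sum of the squared moduli of its entries
  and dominates each of them, so entrywise and global square integrability coincide. Measurability
  of the whole function is tested on basis vectors, each supported in one entry.\<close>

lemma L2m_eq_L2fun: "(L2m M :: ('g \<Rightarrow> complex^'r^'s) set) = L2fun M"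
proof (intro set_eqI iffI)
  fix f :: "'g \<Rightarrow> complex^'r^'s"
  assume f: "f \<in> L2m M"
  have "(\<lambda>x. f x \<bullet> b) \<in> borel_measurable M" if b: "b \<in> Basis" for b
  proof -
    obtain i v where "b = axis i v" "v \<in> Basis"
      using b unfolding Basis_vec_def[where 'a = "complex^'r"] by blast
    moreover from this obtain k u where "v = axis k u"
      by (auto simp: Basis_vec_def)
    moreover have "(\<lambda>x. f x $ i $ k \<bullet> u) \<in> borel_measurable M"
      using f by (auto simp: L2m_def intro: borel_measurable_inner)
    ultimately show ?thesis by (simp add: inner_axis)
  qed
  then have "f \<in> borel_measurable M"
    by (rule borel_measurable_euclidean_space[THEN iffD2, rule_format])
  with f show "f \<in> L2fun M"
    by (auto simp: L2fun_def L2m_def norm_matrix_square)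
next
  fix f :: "'g \<Rightarrow> complex^'r^'s"
  assume f: "f \<in> L2fun M"
  have m: "(\<lambda>x. f x $ i $ k) \<in> borel_measurable M" for i k
    by (rule borel_measurable_continuous_on[OF _ L2fun_measurable[OF f]]) (intro continuous_intros)
  have "integrable M (\<lambda>x. (cmod (f x $ i $ k))\<^sup>2)" for i k
  proof (rule Bochner_Integration.integrable_bound)
    show "integrable M (\<lambda>x. (norm (f x))\<^sup>2)" using f by (simp add: L2fun_def)
    show "(\<lambda>x. (cmod (f x $ i $ k))\<^sup>2) \<in> borel_measurable M" using m by measurable
    have "cmod (A $ i $ k) \<le> norm A" for A :: "complex^'r^'s"
      by (rule order_trans[OF Finite_Cartesian_Product.norm_nth_le Finite_Cartesian_Product.norm_nth_le])
    then show "AE x in M. norm ((cmod (f x $ i $ k))\<^sup>2) \<le> norm ((norm (f x))\<^sup>2)"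
      by (simp add: power_mono)
  qed
  with m show "f \<in> L2m M" by (auto simp: L2m_def)
qed

lemma hinner_eq_sum:
  assumes "f \<in> L2m M" "g \<in> L2m M"
  shows "hinner M f g = (\<Sum>i\<in>UNIV. \<Sum>k\<in>UNIV. LINT x|M. f x $ i $ k * cnj (g x $ i $ k))"
  using assms by (simp add: hinner_def mtrace_def minner_nth)

text \<open>The bridge to the real theory: the real part of the trace of \<open>A B^*\<close> is the
  Euclidean inner product of \<open>A\<close> and \<open>B\<close> as real vectors.\<close>

lemma Re_hinner:
  assumes "f \<in> L2m M" "g \<in> L2m M"
  shows "Re (hinner M f g) = L2_inner M f g"
proof -
  have "integrable M (\<lambda>x. Re (f x $ i $ k * cnj (g x $ i $ k)))" for i k
    by (intro integrable_Re integrable_mult_cnj assms)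
  then show ?thesis
    using assms
    by (simp add: hinner_eq_sum L2_inner_def inner_matrix integral_Re[OF integrable_mult_cnj]
        del: times_complex.simps complex_cnj)
qed

lemma l2norm_eq_L2_norm: "f \<in> L2m M \<Longrightarrow> l2norm M f = L2_norm M f"
  by (simp add: l2norm_def L2_norm_def Re_hinner)

lemma fscale_of_real: "fscale (complex_of_real c) f = (\<lambda>x. c *\<^sub>R f x)"
  by (simp add: fscale_def vec_eq_iff fun_eq_iff complex_eq_iff)

lemma bounded_op_imp_L2_bounded_linear:
  fixes U :: "('g \<Rightarrow> complex^'r^'s) \<Rightarrow> ('g \<Rightarrow> complex^'r^'s)"
  assumes "bounded_op M U"
  shows "L2_bounded_linear M U"
  unfolding L2_bounded_linear_def L2m_eq_L2fun[symmetric]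
proof (intro conjI ballI allI impI)
  fix f :: "'g \<Rightarrow> complex^'r^'s" and c :: real
  assume "f \<in> L2m M"
  then have "ae_eq M (U (fscale (complex_of_real c) f)) (fscale (complex_of_real c) (U f))"
    using assms by (simp add: bounded_op_def)
  then show "AE x in M. U (\<lambda>x. c *\<^sub>R f x) x = c *\<^sub>R U f x"
    by (simp add: ae_eq_def fscale_of_real)
next
  show "\<exists>C. \<forall>f\<in>L2m M. L2_norm M (U f) \<le> C * L2_norm M f"
    using assms by (auto simp: bounded_op_def simp flip: l2norm_eq_L2_norm)
qed (use assms in \<open>auto simp: bounded_op_def ae_eq_def\<close>)

section \<open>Matrix-valued inner products and Parseval's identity\<close>

lemma minner_commute:
  assumes "f \<in> L2m M" "g \<in> L2m M"
  shows "minner M f g $ i $ j = cnj (minner M g f $ j $ i)"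
proof -
  have "(LINT x|M. f x $ i $ k * cnj (g x $ j $ k)) = cnj (LINT x|M. g x $ j $ k * cnj (f x $ i $ k))" for k
    by (subst Bochner_Integration.integral_cnj[symmetric]) (simp add: mult.commute)
  then show ?thesis using assms by (simp add: minner_nth)
qed

lemma minner_cong_left:
  assumes "f \<in> L2m M" "f' \<in> L2m M" "g \<in> L2m M" "ae_eq M f f'"
  shows "minner M f g = minner M f' g"
proof -
  have "minner M f g $ i $ j = minner M f' g $ i $ j" for i j
    unfolding minner_nth[OF assms(1,3)] minner_nth[OF assms(2,3)]
  proof (intro sum.cong refl integral_cong_AE borel_measurable_integrable integrable_mult_cnj assms)
    fix k
    show "AE x in M. f x $ i $ k * cnj (g x $ j $ k) = f' x $ i $ k * cnj (g x $ j $ k)"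
      using assms(4) unfolding ae_eq_def by eventually_elim simp
  qed
  then show ?thesis by (simp add: vec_eq_iff)
qed

text \<open>Left multiplication by \<open>A\<close> is linear on a finite-dimensional space, hence
  continuous and bounded.\<close>

lemma mleft_L2m:
  fixes g :: "'g \<Rightarrow> complex^'r^'s"
  assumes "g \<in> L2m M"
  shows "mleft A g \<in> L2m M"
proof -
  have bl: "linear (\<lambda>B :: complex^'r^'s. A ** B)"
    by (intro linearI) (simp_all add: matrix_matrix_mult_def vec_eq_iff distrib_left sum.distrib
        scaleR_sum_right)
  then obtain C where C: "\<And>B :: complex^'r^'s. norm (A ** B) \<le> C * norm B"
    using linear_bounded by blast
  have g: "g \<in> L2fun M" using assms by (simp add: L2m_eq_L2fun)
  have [measurable]: "mleft A g \<in> borel_measurable M"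
    unfolding mleft_def
    by (rule borel_measurable_continuous_on[OF linear_continuous_on L2fun_measurable[OF g]])
      (simp add: bl linear_conv_bounded_linear[symmetric])
  have "integrable M (\<lambda>x. (norm (mleft A g x))\<^sup>2)"
  proof (rule Bochner_Integration.integrable_bound)
    show "integrable M (\<lambda>x. C\<^sup>2 * (norm (g x))\<^sup>2)" using g by (simp add: L2fun_def)
    show "AE x in M. norm ((norm (mleft A g x))\<^sup>2) \<le> norm (C\<^sup>2 * (norm (g x))\<^sup>2)"
      using C by (auto simp: mleft_def power_mult_distrib[symmetric] intro!: power_mono always_eventually)
  qed measurable
  then show ?thesis by (simp add: L2m_eq_L2fun L2fun_def)
qed

text \<open>Since \<open>f (A g)^* = f g^* A^*\<close>, the constant matrix can be taken out of the
  integral. For \<open>A = minner M f g\<close> the value is the squared norm of the coefficient, as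
  Parseval's identity needs.\<close>

lemma L2_inner_mleft_right:
  assumes f: "f \<in> L2m M" and g: "g \<in> L2m M"
  shows "L2_inner M f (mleft A g) = minner M f g \<bullet> A"
proof -
  have "L2_inner M f (mleft A g) = Re (hinner M f (mleft A g))"
    using f g by (simp add: Re_hinner mleft_L2m)
  also have "hinner M f (mleft A g)
    = (\<Sum>i\<in>UNIV. \<Sum>k\<in>UNIV. LINT x|M. f x $ i $ k * cnj (\<Sum>j\<in>UNIV. A $ i $ j * g x $ j $ k))"
    unfolding hinner_eq_sum[OF f mleft_L2m[OF g]] by (simp add: mleft_def matrix_matrix_mult_def)
  also have "\<dots> = (\<Sum>i\<in>UNIV. \<Sum>k\<in>UNIV. LINT x|M. (\<Sum>j\<in>UNIV. cnj (A $ i $ j) * (f x $ i $ k * cnj (g x $ j $ k))))"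
    by (simp add: sum_distrib_left ac_simps)
  also have "\<dots> = (\<Sum>i\<in>UNIV. \<Sum>k\<in>UNIV. \<Sum>j\<in>UNIV. cnj (A $ i $ j) * (LINT x|M. f x $ i $ k * cnj (g x $ j $ k)))"
    using f g by (simp add: integrable_mult_cnj)
  also have "\<dots> = (\<Sum>i\<in>UNIV. \<Sum>j\<in>UNIV. minner M f g $ i $ j * cnj (A $ i $ j))"
    by (rule sum.cong[OF refl], subst sum.swap)
      (simp add: minner_nth[OF f g] sum_distrib_left mult.commute)
  finally show ?thesis by (simp add: inner_matrix del: times_complex.simps)
qed

text \<open>Pairing \<open>f\<close> with its remainder after \<open>n\<close> terms gives exactly
  the defect in the identity, and Cauchy-Schwarz bounds this by the norm of \<open>f\<close> times
  that of the remainder, which tends to 0.\<close>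

lemma m_onb_Parseval:
  assumes E: "m_onb M E" and f: "f \<in> L2m M"
  shows "(\<lambda>k. (norm (minner M f (E k)))\<^sup>2) sums (L2_norm M f)\<^sup>2"
proof -
  have EL: "E k \<in> L2m M" for k using E by (simp add: m_onb_def)
  let ?S = "\<lambda>n x. \<Sum>k<n. mleft (minner M f (E k)) (E k) x"
  have mL: "mleft (minner M f (E k)) (E k) \<in> L2fun M" for k
    using mleft_L2m[OF EL] by (simp add: L2m_eq_L2fun)
  have fL: "f \<in> L2fun M" using f by (simp add: L2m_eq_L2fun)
  have DL: "(\<lambda>x. f x - ?S n x) \<in> L2fun M" for n
    by (intro L2fun_diff L2fun_sum mL fL)
  have lim: "(\<lambda>n. L2_norm M (\<lambda>x. f x - ?S n x)) \<longlonglongrightarrow> 0"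
    using E f unfolding m_onb_def l2norm_eq_L2_norm[OF DL[folded L2m_eq_L2fun], symmetric] by blast
  have "L2_inner M f (\<lambda>x. f x - ?S n x)
    = (L2_norm M f)\<^sup>2 - (\<Sum>k<n. (norm (minner M f (E k)))\<^sup>2)" for n
    using fL f EL
    by (simp add: L2_inner_diff_right L2fun_sum mL L2_inner_sum_right L2_norm_square
        L2_inner_mleft_right power2_norm_eq_inner)
  then have "\<bar>(\<Sum>k<n. (norm (minner M f (E k)))\<^sup>2) - (L2_norm M f)\<^sup>2\<bar>
      \<le> L2_norm M f * L2_norm M (\<lambda>x. f x - ?S n x)" for n
    using L2_Cauchy_Schwarz[OF fL DL[of n]] by (simp add: abs_minus_commute)
  then have "(\<lambda>n. (\<Sum>k<n. (norm (minner M f (E k)))\<^sup>2) - (L2_norm M f)\<^sup>2) \<longlonglongrightarrow> 0"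
    by (intro Lim_null_comparison[OF _ tendsto_mult_right_zero[OF lim, of "L2_norm M f"]]) (simp add: always_eventually)
  then show ?thesis unfolding sums_def by (simp add: LIM_zero_cancel)
qed

text \<open>The coefficients of \<open>T f\<close> with respect to \<open>E\<close> are those of \<open>V\<^sup>* f\<close> with respect to \<open>E'\<close>.\<close>
lemma m_riesz_basis_imp_bounded_below:
  fixes T :: "('g \<Rightarrow> complex^'r^'s) \<Rightarrow> ('g \<Rightarrow> complex^'r^'s)"
  assumes T: "positive_op M T" "m_adjointable M T"
    and E: "m_onb M E" and R: "m_riesz_basis M (\<lambda>k. T (E k))"
  obtains c where "0 < c" "\<And>f. f \<in> L2m M \<Longrightarrow> c * L2_norm M f \<le> L2_norm M (T f)"
proof -
  have TL: "T f \<in> L2m M" if "f \<in> L2m M" for f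
    using T(1) that by (auto simp: positive_op_def bounded_op_def)
  obtain E' V where E': "m_onb M E'" and V: "bounded_op M V" "bij_op M V" "m_adjointable M V"
    and TV: "\<And>k. ae_eq M (T (E k)) (V (E' k))"
    using R by (auto simp: m_riesz_basis_def)
  obtain W where W: "is_hadjoint M V W"
    and Wm: "\<And>f g. f \<in> L2m M \<Longrightarrow> g \<in> L2m M \<Longrightarrow> minner M (V f) g = minner M f (W g)"
    using V(3) by (auto simp: m_adjointable_def)
  obtain T' where T': "is_hadjoint M T T'"
    and T'm: "\<And>f g. f \<in> L2m M \<Longrightarrow> g \<in> L2m M \<Longrightarrow> minner M (T f) g = minner M f (T' g)"
    using T(2) by (auto simp: m_adjointable_def)
  have L: "V f \<in> L2m M" "W f \<in> L2m M" "T' f \<in> L2m M" if "f \<in> L2m M" for f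
    using V(1) W T' that by (auto simp: bounded_op_def is_hadjoint_def)
  have EL: "E k \<in> L2m M" "E' k \<in> L2m M" for k
    using E E' by (auto simp: m_onb_def)
  have "L2_norm M (W f) = L2_norm M (T f)" if f: "f \<in> L2m M" for f
  proof -
    \<comment> \<open>The adjoint \<open>T'\<close> from matrix adjointability need not be
      \<open>T\<close> literally, but \<open>T\<close> is its own Hilbert adjoint, so
      \<open>T' f\<close> and \<open>T f\<close> have the same inner products. Testing with
      \<open>g = T' f\<close> and \<open>g = T f\<close> equates their norms.\<close>
    have "L2_inner M g (T' f) = L2_inner M g (T f)" if g: "g \<in> L2m M" for g
    proof -
      have "hinner M g (T' f) = hinner M g (T f)"
        using T(1) T' f g by (metis is_hadjoint_def positive_op_def)
      then show ?thesis using f g by (simp add: Re_hinner[symmetric] TL L)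
    qed
    from this[OF L(3)[OF f]] this[OF TL[OF f]]
    have "(L2_norm M (T' f))\<^sup>2 = (L2_norm M (T f))\<^sup>2"
      by (simp add: L2_norm_square L2_inner_commute)
    then have norm: "L2_norm M (T' f) = L2_norm M (T f)"
      by (simp add: power2_eq_iff_nonneg)
    \<comment> \<open>The adjoint relations have the basis vector on the left and Parseval's
      identity has it on the right; \<open>minner_commute\<close> passes between the two.\<close>
    have "minner M (W f) (E' k) = minner M (T' f) (E k)" for k
    proof -
      have "minner M (E' k) (W f) = minner M (T (E k)) f"
        using Wm[OF EL(2) f] minner_cong_left[OF TL[OF EL(1)] L(1)[OF EL(2)] f TV] by simp
      also have "\<dots> = minner M (E k) (T' f)" by (rule T'm[OF EL(1) f])
      finally show ?thesis
        unfolding vec_eq_iff minner_commute[OF L(2)[OF f] EL(2)] minner_commute[OF L(3)[OF f] EL(1)]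
        by simp
    qed
    then have "(L2_norm M (W f))\<^sup>2 = (L2_norm M (T' f))\<^sup>2"
      using sums_unique2[OF m_onb_Parseval[OF E' L(2)[OF f]]] m_onb_Parseval[OF E L(3)[OF f]] by simp
    with norm show ?thesis by (simp add: power2_eq_iff_nonneg)
  qed
  moreover have "\<exists>c>0. \<forall>f\<in>L2fun M. c * L2_norm M f \<le> L2_norm M (W f)"
  proof (rule surj_imp_adjoint_bounded_below)
    show "V f \<in> L2fun M" if "f \<in> L2fun M" for f
      using L(1) that by (simp add: L2m_eq_L2fun)
    show "\<exists>g\<in>L2fun M. AE x in M. V g x = h x" if "h \<in> L2fun M" for h
      using V(2) that by (simp add: bij_op_def ae_eq_def L2m_eq_L2fun)
    show "L2_bounded_linear M W"
      using W by (simp add: is_hadjoint_def bounded_op_imp_L2_bounded_linear)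
    show "L2_inner M (V f) g = L2_inner M f (W g)" if "f \<in> L2fun M" "g \<in> L2fun M" for f g
    proof -
      have fg: "f \<in> L2m M" "g \<in> L2m M" using that by (simp_all add: L2m_eq_L2fun)
      then have "hinner M (V f) g = hinner M f (W g)" using W by (simp add: is_hadjoint_def)
      then show ?thesis using fg L by (simp add: Re_hinner[symmetric])
    qed
  qed
  ultimately show ?thesis using that by (auto simp: L2m_eq_L2fun)
qed

section \<open>From coercivity to the Riesz basis\<close>

text \<open>Coercivity applied to \<open>f - g\<close>, whose image vanishes almost everywhere,
  gives injectivity; surjectivity comes from the Neumann series.\<close>

lemma coercive_imp_bij_op:
  fixes U :: "('g \<Rightarrow> complex^'r^'s) \<Rightarrow> ('g \<Rightarrow> complex^'r^'s)"
  assumes U: "bounded_op M U" and m: "0 < m"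
    and coercive: "\<And>f. f \<in> L2m M \<Longrightarrow> m * (L2_norm M f)\<^sup>2 \<le> L2_inner M (U f) f"
  shows "bij_op M U"
  unfolding bij_op_def
proof (intro conjI ballI impI)
  fix f g :: "'g \<Rightarrow> complex^'r^'s"
  assume f: "f \<in> L2m M" and g: "g \<in> L2m M" and eq: "ae_eq M (U f) (U g)"
  let ?d = "\<lambda>x. f x - g x"
  note lin = bounded_op_imp_L2_bounded_linear[OF U]
  have fg: "f \<in> L2fun M" "g \<in> L2fun M" using f g by (simp_all add: L2m_eq_L2fun)
  have d: "?d \<in> L2fun M" by (rule L2fun_diff[OF fg])
  have "AE x in M. U ?d x = 0"
    using L2_bounded_linear_diff[OF lin fg] eq unfolding ae_eq_def by eventually_elim simp
  then have "L2_inner M (U ?d) ?d = L2_inner M (\<lambda>x. 0) ?d"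
    by (intro L2_inner_cong_AE L2_bounded_linear_closed[OF lin] d) auto
  then have "m * (L2_norm M ?d)\<^sup>2 \<le> 0"
    using coercive[of ?d] d by (simp add: L2m_eq_L2fun L2_inner_def)
  then have "L2_norm M ?d = 0" using m by (simp add: mult_le_0_iff)
  then show "ae_eq M f g" using d by (simp add: L2_norm_eq_0_iff ae_eq_def)
next
  fix h :: "'g \<Rightarrow> complex^'r^'s"
  assume "h \<in> L2m M"
  then show "\<exists>f\<in>L2m M. ae_eq M (U f) h"
    using coercive_imp_surj[OF bounded_op_imp_L2_bounded_linear[OF U] m] coercive
    by (simp add: L2m_eq_L2fun ae_eq_def)
qed

theorem theorem3p13:
  fixes M :: "'g::topological_ab_group_add measure"
    and T \<Omega> :: "('g \<Rightarrow> complex^'r::finite^'s::finite) \<Rightarrow> ('g \<Rightarrow> complex^'r^'s)"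
    and E :: "nat \<Rightarrow> 'g \<Rightarrow> complex^'r^'s"
  assumes "metr_sigma_compact_LCA TYPE('g)"
    and "haar_measure M"
    and "bounded_op M T" and "positive_op M T" and "m_adjointable M T"
    and "bounded_op M \<Omega>" and "positive_op M \<Omega>" and "m_adjointable M \<Omega>"
    and "m_onb M E"
    and "m_riesz_basis M (\<lambda>k. T (E k))"
    and "\<forall>f\<in>L2m M. Re (hinner M (T f) f) \<le> Re (hinner M (\<Omega> f) f)"
  shows "m_riesz_basis M (\<lambda>k. \<Omega> (E k))"
proof -
  have L: "T f \<in> L2m M" "\<Omega> f \<in> L2m M" if "f \<in> L2m M" for f
    using assms(3,6) that by (auto simp: bounded_op_def)
  obtain c where c: "0 < c" "\<And>f. f \<in> L2m M \<Longrightarrow> c * L2_norm M f \<le> L2_norm M (T f)"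
    using m_riesz_basis_imp_bounded_below[OF assms(4,5,9,10)] by blast
  obtain m where m: "0 < m" "\<And>f. f \<in> L2m M \<Longrightarrow> m * (L2_norm M f)\<^sup>2 \<le> L2_inner M (T f) f"
  proof (rule positive_bounded_below_imp_coercive[of M T, folded L2m_eq_L2fun])
    show "L2_bounded_linear M T" by (rule bounded_op_imp_L2_bounded_linear[OF assms(3)])
    show "L2_inner M (T f) g = L2_inner M f (T g)" if "f \<in> L2m M" "g \<in> L2m M" for f g
    proof -
      have "hinner M (T f) g = hinner M f (T g)"
        using assms(4) that by (simp add: positive_op_def is_hadjoint_def)
      then show ?thesis using that L by (simp add: Re_hinner[symmetric])
    qed
    show "0 \<le> L2_inner M (T f) f" if "f \<in> L2m M" for f
      using assms(4) that L by (simp add: positive_op_def Re_hinner[symmetric])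
  qed (use c in auto)
  \<comment> \<open>The order assumption carries the constant \<open>m\<close> from \<open>T\<close>
    to \<open>\<Omega>\<close>, after which \<open>\<Omega>\<close> serves as the bijection and
    \<open>E\<close> as the orthonormal basis.\<close>
  have "m * (L2_norm M f)\<^sup>2 \<le> L2_inner M (\<Omega> f) f" if "f \<in> L2m M" for f
    using m(2)[OF that] assms(11) that L by (fastforce simp: Re_hinner)
  then have "bij_op M \<Omega>"
    by (rule coercive_imp_bij_op[OF assms(6) m(1)])
  then show ?thesis
    using assms(6,8,9) by (auto simp: m_riesz_basis_def ae_eq_def)
qed

end
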